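(* Let $\{X_\lambda:\lambda\in\Lambda\}$ be a nonempty family of nonzero Banach spaces over the same field ($\mathbb{R}$ or $\mathbb{C}$), let $1\leq p<\infty$ and $k\in\mathbb{N}$. Suppose $X$ is either $[\oplus_{\lambda\in\Lambda}X_\lambda]_{\ell_q}$ for some $1\leq q\leq\infty$, or $[\oplus_{\lambda\in\Lambda}X_\lambda]_{c_0}$. Then \[n_{(p,k)}(X)\leq\inf\{n_{(p,k)}(X_\lambda):\lambda\in\Lambda\}.\]
   Context: $[\oplus_{\lambda\in\Lambda}X_\lambda]_{\ell_q}$ and $[\oplus_{\lambda\in\Lambda}X_\lambda]_{c_0}$ denote the $\ell_q$-sum and the $c_0$-sum of the family (the $c_0$-sum carries the supremum norm). For a Banach space $X$, $L(X)$ is the space of bounded linear operators on $X$, $S_X$ its unit sphere, $X^*$ its dual, and $\Pi_X=\{(x,x^* )\in S_X\times S_{X^*}: x^*(x)=1\}$. For $1\leq p<\infty$, $k\in\mathbb{N}$ and $\mathcal{T}=(T_1,\ldots,T_k)\in L(X)^k$, put $\|\mathcal{T}\|_p=\sup\{(\sum_{i=1}^k\|T_ix\|^p)^{1/p}:x\in S_X\}$ and $w_p(\mathcal{T})=\sup\{(\sum_{i=1}^k|x^*(T_ix)|^p)^{1/p}:(x,x^* )\in\Pi_X\}$. The $(p,k)$-th joint numerical index of $X$ is $n_{(p,k)}(X)=\inf\{w_p(\mathcal{T}):\mathcal{T}\in L(X)^k,\ \|\mathcal{T}\|_p=1\}$. *)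

theory Defs
  imports "HOL-Analysis.Analysis" "HOL-Algebra.Module"
begin

text \<open>
  The spaces of a family have different carriers and operations, so normed spaces are
  records with an explicit carrier: HOL-Algebra modules with a norm. The scalar field is a
  set \<open>K\<close> of complex numbers, either \<open>\<real>\<close> or \<open>UNIV\<close>. The fields \<open>mult\<close> and \<open>one\<close> inherited
  from the HOL-Algebra record of modules have no meaning for a normed space.
\<close>

record 'a normed_module = "(complex, 'a) module" +
  nrm :: "'a \<Rightarrow> real"

definition scalars :: "complex set \<Rightarrow> complex normed_module" where
  "scalars K = \<lparr>carrier = K, monoid.mult = (*), one = 1, zero = 0, add = (+),
     smult = (*), nrm = cmod\<rparr>"

locale normed_space = module "scalars K" V for K :: "complex set" and V :: "'a normed_module" +
  assumes nrm_eq_0_iff: "x \<in> carrier V \<Longrightarrow> nrm V x = 0 \<longleftrightarrow> x = \<zero>\<^bsub>V\<^esub>"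
    and nrm_triangle: "\<lbrakk>x \<in> carrier V; y \<in> carrier V\<rbrakk>
          \<Longrightarrow> nrm V (x \<oplus>\<^bsub>V\<^esub> y) \<le> nrm V x + nrm V y"
    and nrm_smult: "\<lbrakk>c \<in> K; x \<in> carrier V\<rbrakk> \<Longrightarrow> nrm V (c \<odot>\<^bsub>V\<^esub> x) = cmod c * nrm V x"

text \<open>
  The value \<open>0\<close> outside the carrier is only there because the locale \<open>Metric_space\<close> requires
  nonnegativity and symmetry on the whole type.
\<close>

definition nrm_dist :: "'a normed_module \<Rightarrow> 'a \<Rightarrow> 'a \<Rightarrow> real" where
  "nrm_dist V x y =
     (if x \<in> carrier V \<and> y \<in> carrier V then nrm V (x \<ominus>\<^bsub>V\<^esub> y) else 0)"

locale banach_space = normed_space +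
  assumes complete: "Metric_space.mcomplete (carrier V) (nrm_dist V)"

definition unit_sphere :: "'a normed_module \<Rightarrow> 'a set" where
  "unit_sphere V = {x \<in> carrier V. nrm V x = 1}"

definition bounded_operators ::
    "complex set \<Rightarrow> 'a normed_module \<Rightarrow> 'b normed_module \<Rightarrow> ('a \<Rightarrow> 'b) set" where
  "bounded_operators K V W =
     {T \<in> carrier V \<rightarrow> carrier W.
        (\<forall>x\<in>carrier V. \<forall>y\<in>carrier V. T (x \<oplus>\<^bsub>V\<^esub> y) = T x \<oplus>\<^bsub>W\<^esub> T y) \<and>
        (\<forall>c\<in>K. \<forall>x\<in>carrier V. T (c \<odot>\<^bsub>V\<^esub> x) = c \<odot>\<^bsub>W\<^esub> T x) \<and>
        (\<exists>C. \<forall>x\<in>carrier V. nrm W (T x) \<le> C * nrm V x)}"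

text \<open>
  All suprema and infima below are of nonnegative numbers and are taken in \<open>[0, \<infinity>]\<close>, so that
  they need no side conditions of nonemptiness and boundedness.
\<close>

definition op_norm :: "'a normed_module \<Rightarrow> 'b normed_module \<Rightarrow> ('a \<Rightarrow> 'b) \<Rightarrow> ennreal" where
  "op_norm V W T = (SUP x\<in>{x \<in> carrier V. nrm V x \<le> 1}. ennreal (nrm W (T x)))"

definition dual_sphere :: "complex set \<Rightarrow> 'a normed_module \<Rightarrow> ('a \<Rightarrow> complex) set" where
  "dual_sphere K V = {f \<in> bounded_operators K V (scalars K). op_norm V (scalars K) f = 1}"

definition Pi_set :: "complex set \<Rightarrow> 'a normed_module \<Rightarrow> ('a \<times> ('a \<Rightarrow> complex)) set" where
  "Pi_set K V = {(x, f) \<in> unit_sphere V \<times> dual_sphere K V. f x = 1}"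

text \<open>
  A tuple \<open>(T\<^sub>1, \<dots>, T\<^sub>k)\<close> is a function on \<open>nat\<close> of which only the values at \<open>1, \<dots>, k\<close> matter.
\<close>

definition joint_norm ::
    "real \<Rightarrow> nat \<Rightarrow> 'a normed_module \<Rightarrow> (nat \<Rightarrow> 'a \<Rightarrow> 'a) \<Rightarrow> ennreal" where
  "joint_norm p k V T =
     (SUP x\<in>unit_sphere V. ennreal ((\<Sum>i=1..k. nrm V (T i x) powr p) powr (1 / p)))"

definition joint_numerical_radius ::
    "complex set \<Rightarrow> real \<Rightarrow> nat \<Rightarrow> 'a normed_module \<Rightarrow> (nat \<Rightarrow> 'a \<Rightarrow> 'a) \<Rightarrow> ennreal" where
  "joint_numerical_radius K p k V T =
     (SUP (x, f)\<in>Pi_set K V. ennreal ((\<Sum>i=1..k. cmod (f (T i x)) powr p) powr (1 / p)))"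

definition joint_numerical_index ::
    "complex set \<Rightarrow> real \<Rightarrow> nat \<Rightarrow> 'a normed_module \<Rightarrow> ennreal" where
  "joint_numerical_index K p k V =
     (INF T\<in>{T. (\<forall>i\<in>{1..k}. T i \<in> bounded_operators K V V) \<and> joint_norm p k V T = 1}.
        joint_numerical_radius K p k V T)"

text \<open>
  \<open>family_space I X S N\<close> is the set \<open>S\<close> of elements of the product of the family, with
  the coordinatewise operations and the norm \<open>N\<close>.
\<close>

definition family_space ::
    "'i set \<Rightarrow> ('i \<Rightarrow> 'a normed_module) \<Rightarrow> ('i \<Rightarrow> 'a) set \<Rightarrow> (('i \<Rightarrow> 'a) \<Rightarrow> real)
       \<Rightarrow> ('i \<Rightarrow> 'a) normed_module" where
  "family_space I X S N =
     \<lparr>carrier = S, monoid.mult = undefined, one = undefined,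
      zero = (\<lambda>l\<in>I. \<zero>\<^bsub>X l\<^esub>),
      add = (\<lambda>x y. \<lambda>l\<in>I. x l \<oplus>\<^bsub>X l\<^esub> y l),
      smult = (\<lambda>c x. \<lambda>l\<in>I. c \<odot>\<^bsub>X l\<^esub> x l),
      nrm = N\<rparr>"

definition sup_nrm :: "'i set \<Rightarrow> ('i \<Rightarrow> 'a normed_module) \<Rightarrow> ('i \<Rightarrow> 'a) \<Rightarrow> real" where
  "sup_nrm I X x = (SUP l\<in>I. nrm (X l) (x l))"

definition lq_sum ::
    "ereal \<Rightarrow> 'i set \<Rightarrow> ('i \<Rightarrow> 'a normed_module) \<Rightarrow> ('i \<Rightarrow> 'a) normed_module" where
  "lq_sum q I X =
     (if q = \<infinity> then
        family_space I X
          {x \<in> (\<Pi>\<^sub>E l\<in>I. carrier (X l)). bdd_above ((\<lambda>l. nrm (X l) (x l)) ` I)}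
          (sup_nrm I X)
      else let r = real_of_ereal q in
        family_space I X
          {x \<in> (\<Pi>\<^sub>E l\<in>I. carrier (X l)). (\<lambda>l. nrm (X l) (x l) powr r) summable_on I}
          (\<lambda>x. (\<Sum>\<^sub>\<infinity>l\<in>I. nrm (X l) (x l) powr r) powr (1 / r)))"

definition c0_sum :: "'i set \<Rightarrow> ('i \<Rightarrow> 'a normed_module) \<Rightarrow> ('i \<Rightarrow> 'a) normed_module" where
  "c0_sum I X =
     family_space I X
       {x \<in> (\<Pi>\<^sub>E l\<in>I. carrier (X l)). \<forall>\<epsilon>>0. finite {l \<in> I. nrm (X l) (x l) \<ge> \<epsilon>}}
       (sup_nrm I X)"

end

theory Submission
  imports Defs
begin

text \<open>
  An operator tuple on a summand \<open>X l\<close> is extended by zero to the sum \<open>Y\<close>, which preserves its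
  joint norm. The point is that a norming pair \<open>(y, f)\<close> of \<open>Y\<close> restricts to a multiple of a norming
  pair of \<open>X l\<close>: replacing the coordinate \<open>y l\<close> by any \<open>u\<close> with \<open>\<parallel>u\<parallel> \<le> \<parallel>y l\<parallel>\<close> does not increase the
  norm of \<open>y\<close>, so the restriction of \<open>Re f\<close> to the ball of radius \<open>\<parallel>y l\<parallel>\<close> in \<open>X l\<close> is maximal
  at \<open>y l\<close>. Only this monotonicity of the norm of \<open>Y\<close> and isometry of the coordinate embeddings
  are used, so that no duality for \<open>\<ell>\<^sub>q\<close>-sums is needed.
\<close>

section \<open>Sums of powers and functionals of norm one\<close>

lemma scalars_simps [simp]:
  "carrier (scalars K) = K" "\<zero>\<^bsub>scalars K\<^esub> = 0" "\<one>\<^bsub>scalars K\<^esub> = 1"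
  "x \<oplus>\<^bsub>scalars K\<^esub> y = x + y" "x \<otimes>\<^bsub>scalars K\<^esub> y = x * y" "c \<odot>\<^bsub>scalars K\<^esub> x = c * x"
  "nrm (scalars K) x = cmod x"
  by (simp_all add: scalars_def)

lemma family_space_simps [simp]:
  "carrier (family_space I X S N) = S"
  "\<zero>\<^bsub>family_space I X S N\<^esub> = (\<lambda>l\<in>I. \<zero>\<^bsub>X l\<^esub>)"
  "x \<oplus>\<^bsub>family_space I X S N\<^esub> y = (\<lambda>l\<in>I. x l \<oplus>\<^bsub>X l\<^esub> y l)"
  "c \<odot>\<^bsub>family_space I X S N\<^esub> x = (\<lambda>l\<in>I. c \<odot>\<^bsub>X l\<^esub> x l)"
  "nrm (family_space I X S N) x = N x"
  by (simp_all add: family_space_def)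

lemma powr_sum_mono:
  fixes a b :: "'i \<Rightarrow> real"
  assumes "0 < p" "\<And>i. i \<in> A \<Longrightarrow> 0 \<le> a i" "\<And>i. i \<in> A \<Longrightarrow> a i \<le> b i"
  shows "(\<Sum>i\<in>A. a i powr p) powr (1 / p) \<le> (\<Sum>i\<in>A. b i powr p) powr (1 / p)"
  using assms by (intro powr_mono2 sum_mono sum_nonneg) auto

lemma bounded_operatorsD:
  assumes "T \<in> bounded_operators K V W"
  shows "x \<in> carrier V \<Longrightarrow> T x \<in> carrier W"
    and "\<lbrakk>x \<in> carrier V; y \<in> carrier V\<rbrakk> \<Longrightarrow> T (x \<oplus>\<^bsub>V\<^esub> y) = T x \<oplus>\<^bsub>W\<^esub> T y"
    and "\<lbrakk>c \<in> K; x \<in> carrier V\<rbrakk> \<Longrightarrow> T (c \<odot>\<^bsub>V\<^esub> x) = c \<odot>\<^bsub>W\<^esub> T x"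
  using assms by (auto simp: bounded_operators_def)

lemma dual_sphere_bound:
  assumes "f \<in> dual_sphere K V" "x \<in> carrier V" "nrm V x \<le> 1"
  shows "cmod (f x) \<le> 1"
proof -
  have "ennreal (cmod (f x)) \<le> op_norm V (scalars K) f"
    unfolding op_norm_def using assms by (intro SUP_upper2[of x]) auto
  also have "\<dots> = 1"
    using assms by (simp add: dual_sphere_def)
  finally show ?thesis
    by simp
qed

text \<open>The bound keeps \<open>f\<close> at most 1 in modulus on the unit ball and
  \<open>u\<close> attains the value 1, so the operator norm is exactly 1.\<close>

lemma dual_sphereI:
  assumes f: "f \<in> carrier V \<rightarrow> K"
    and "\<And>x y. \<lbrakk>x \<in> carrier V; y \<in> carrier V\<rbrakk> \<Longrightarrow> f (x \<oplus>\<^bsub>V\<^esub> y) = f x + f y"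
    and "\<And>c x. \<lbrakk>c \<in> K; x \<in> carrier V\<rbrakk> \<Longrightarrow> f (c \<odot>\<^bsub>V\<^esub> x) = c * f x"
    and bound: "\<And>x. x \<in> carrier V \<Longrightarrow> cmod (f x) \<le> nrm V x"
    and u: "u \<in> unit_sphere V" "f u = 1"
  shows "f \<in> dual_sphere K V"
proof -
  have "\<exists>C. \<forall>x\<in>carrier V. cmod (f x) \<le> C * nrm V x"
    by (rule exI[of _ 1]) (simp add: bound)
  then have "f \<in> bounded_operators K V (scalars K)"
    using assms by (simp add: bounded_operators_def)
  moreover have "op_norm V (scalars K) f = 1"
    unfolding op_norm_def
  proof (rule antisym)
    show "(SUP x\<in>{x \<in> carrier V. nrm V x \<le> 1}. ennreal (nrm (scalars K) (f x))) \<le> 1"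
      using bound by (intro SUP_least) (auto intro: order_trans)
    show "1 \<le> (SUP x\<in>{x \<in> carrier V. nrm V x \<le> 1}. ennreal (nrm (scalars K) (f x)))"
      using u by (intro SUP_upper2[of u]) (auto simp: unit_sphere_def)
  qed
  ultimately show ?thesis
    by (simp add: dual_sphere_def)
qed

section \<open>Nonnegativity of the norm and normalisation of vectors\<close>

context normed_space
begin

lemma nrm_zero [simp]: "nrm V \<zero>\<^bsub>V\<^esub> = 0"
  using nrm_eq_0_iff by simp

text \<open>Nonnegativity is not an axiom of \<open>normed_space\<close>. It comes from the triangle
  inequality for \<open>x\<close> and its negative, whose norms agree and whose sum has norm
  0.\<close>

lemma nrm_nonneg:
  assumes "x \<in> carrier V" "-1 \<in> K"
  shows "0 \<le> nrm V x"
proof -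
  have one: "1 \<in> K"
    using R.one_closed by simp
  have "(1 + -1) \<odot>\<^bsub>V\<^esub> x = 1 \<odot>\<^bsub>V\<^esub> x \<oplus>\<^bsub>V\<^esub> (-1) \<odot>\<^bsub>V\<^esub> x"
    using smult_l_distr[of 1 "-1" x] assms one by simp
  moreover have "0 \<odot>\<^bsub>V\<^esub> x = \<zero>\<^bsub>V\<^esub>" "1 \<odot>\<^bsub>V\<^esub> x = x"
    using smult_l_null[of x] smult_one[of x] assms by simp_all
  ultimately have "x \<oplus>\<^bsub>V\<^esub> (-1) \<odot>\<^bsub>V\<^esub> x = \<zero>\<^bsub>V\<^esub>"
    by simp
  moreover have "(-1) \<odot>\<^bsub>V\<^esub> x \<in> carrier V"
    using smult_closed[of "-1" x] assms by simp
  ultimately have "0 \<le> nrm V x + nrm V ((-1) \<odot>\<^bsub>V\<^esub> x)"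
    using nrm_triangle[of x "(-1) \<odot>\<^bsub>V\<^esub> x"] assms by simp
  then show ?thesis
    using nrm_smult[of "-1" x] assms by simp
qed

lemma bounded_operator_zero:
  assumes "T \<in> bounded_operators K V V"
  shows "T \<zero>\<^bsub>V\<^esub> = \<zero>\<^bsub>V\<^esub>"
proof -
  have "0 \<in> K"
    using R.zero_closed by simp
  then have "T (0 \<odot>\<^bsub>V\<^esub> \<zero>\<^bsub>V\<^esub>) = 0 \<odot>\<^bsub>V\<^esub> T \<zero>\<^bsub>V\<^esub>"
    using bounded_operatorsD[OF assms] by blast
  then show ?thesis
    using smult_l_null[of "T \<zero>\<^bsub>V\<^esub>"] smult_l_null[of "\<zero>\<^bsub>V\<^esub>"] bounded_operatorsD(1)[OF assms]
    by simp
qed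

lemma unit_vector:
  assumes "v \<in> carrier V" "nrm V v \<noteq> 0" "\<real> \<subseteq> K"
  obtains u where "u \<in> unit_sphere V" "v = complex_of_real (nrm V v) \<odot>\<^bsub>V\<^esub> u"
proof
  let ?s = "complex_of_real (nrm V v)"
  have K: "?s \<in> K" "inverse ?s \<in> K" and "-1 \<in> K"
    using assms(3) by auto
  then have "0 < nrm V v"
    using nrm_nonneg[OF assms(1)] assms(2) by simp
  then show "inverse ?s \<odot>\<^bsub>V\<^esub> v \<in> unit_sphere V"
    using K assms(1) smult_closed[of "inverse ?s" v] nrm_smult[of "inverse ?s" v]
    by (simp add: unit_sphere_def norm_inverse)
  show "v = ?s \<odot>\<^bsub>V\<^esub> (inverse ?s \<odot>\<^bsub>V\<^esub> v)"
    using K assms smult_assoc1[of ?s "inverse ?s" v] smult_one[of v] by simp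
qed

end

section \<open>One summand inside a sum with a monotone norm\<close>

text \<open>The properties of an l_q- or c_0-sum, seen from one fixed summand \<open>l\<close>, from
  which the index inequality follows. They constrain \<open>N\<close> only through the coordinate
  \<open>l\<close>, so instantiating them does not involve the triangle inequality in the
  sum.\<close>

locale monotone_sum =
  fixes K :: "complex set" and I :: "'i set" and X :: "'i \<Rightarrow> 'a normed_module"
    and S :: "('i \<Rightarrow> 'a) set" and N :: "('i \<Rightarrow> 'a) \<Rightarrow> real" and l :: 'i
  assumes K: "K = \<real> \<or> K = UNIV"
    and normed: "\<And>j. j \<in> I \<Longrightarrow> normed_space K (X j)"
    and l: "l \<in> I"
    and S_subset: "S \<subseteq> (\<Pi>\<^sub>E j\<in>I. carrier (X j))"
    and embedding_mem: "\<And>u. u \<in> carrier (X l) \<Longrightarrow> (\<lambda>j\<in>I. if j = l then u else \<zero>\<^bsub>X j\<^esub>) \<in> S"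
    and nrm_embedding: "\<And>u. u \<in> carrier (X l) \<Longrightarrow>
          N (\<lambda>j\<in>I. if j = l then u else \<zero>\<^bsub>X j\<^esub>) = nrm (X l) u"
    and coordinate_le: "\<And>y. y \<in> S \<Longrightarrow> nrm (X l) (y l) \<le> N y"
    and update_mem: "\<And>y u. \<lbrakk>y \<in> S; u \<in> carrier (X l); nrm (X l) u \<le> nrm (X l) (y l)\<rbrakk>
          \<Longrightarrow> y(l := u) \<in> S"
    and update_le: "\<And>y u. \<lbrakk>y \<in> S; u \<in> carrier (X l); nrm (X l) u \<le> nrm (X l) (y l)\<rbrakk>
          \<Longrightarrow> N (y(l := u)) \<le> N y"
begin

abbreviation Y where "Y \<equiv> family_space I X S N"

definition E where "E u = (\<lambda>j\<in>I. if j = l then u else \<zero>\<^bsub>X j\<^esub>)"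

sublocale Xl: normed_space K "X l"
  using normed l .

lemma reals_subset: "\<real> \<subseteq> K" and minus_one_mem: "-1 \<in> K"
  using K by auto

lemma mult_mem: "a \<in> K \<Longrightarrow> b \<in> K \<Longrightarrow> a * b \<in> K"
  using K by auto

lemma E_mem: "u \<in> carrier (X l) \<Longrightarrow> E u \<in> S"
  and N_E: "u \<in> carrier (X l) \<Longrightarrow> N (E u) = nrm (X l) u"
  unfolding E_def using embedding_mem nrm_embedding by auto

lemma E_apply: "E u l = u"
  using l by (simp add: E_def)

lemma E_add: "E (u \<oplus>\<^bsub>X l\<^esub> v) = E u \<oplus>\<^bsub>Y\<^esub> E v"
proof -
  have "\<zero>\<^bsub>X j\<^esub> \<oplus>\<^bsub>X j\<^esub> \<zero>\<^bsub>X j\<^esub> = \<zero>\<^bsub>X j\<^esub>" if "j \<in> I" for j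
  proof -
    interpret normed_space K "X j"
      using normed that .
    show ?thesis
      by simp
  qed
  then show ?thesis
    by (auto simp: E_def fun_eq_iff restrict_def)
qed

lemma E_smult:
  assumes "c \<in> K"
  shows "E (c \<odot>\<^bsub>X l\<^esub> u) = c \<odot>\<^bsub>Y\<^esub> E u"
proof -
  have "c \<odot>\<^bsub>X j\<^esub> \<zero>\<^bsub>X j\<^esub> = \<zero>\<^bsub>X j\<^esub>" if "j \<in> I" for j
  proof -
    interpret normed_space K "X j"
      using normed that .
    show ?thesis
      using assms by simp
  qed
  then show ?thesis
    by (auto simp: E_def fun_eq_iff restrict_def)
qed

lemma coordinate_mem: "y \<in> S \<Longrightarrow> y l \<in> carrier (X l)"
  using S_subset l by (auto simp: PiE_iff)

text \<open>Turns the change of one coordinate into an addition, so that additivity of a functional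
  on \<open>Y\<close> applies to \<open>y(l := u)\<close>.\<close>

lemma update_eq_add:
  assumes "y \<in> S" "u \<in> carrier (X l)"
  shows "y(l := u) = y \<oplus>\<^bsub>Y\<^esub> E (u \<ominus>\<^bsub>X l\<^esub> y l)"
proof
  fix j
  show "(y(l := u)) j = (y \<oplus>\<^bsub>Y\<^esub> E (u \<ominus>\<^bsub>X l\<^esub> y l)) j"
  proof (cases "j \<in> I")
    case True
    interpret normed_space K "X j"
      using normed True .
    have "y j \<in> carrier (X j)"
      using assms S_subset True by (auto simp: PiE_iff)
    moreover have "y l \<oplus>\<^bsub>X l\<^esub> (u \<ominus>\<^bsub>X l\<^esub> y l) = u"
      using assms(2) coordinate_mem[OF assms(1)]
      by (simp add: a_minus_def Xl.M.a_ac Xl.M.r_neg)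
    ultimately show ?thesis
      using True by (auto simp: E_def)
  next
    case False
    \<comment> \<open>Outside \<open>I\<close> both sides are \<open>undefined\<close>, since
      \<open>y\<close> is extensional and \<open>l\<close> lies in \<open>I\<close>.\<close>
    then show ?thesis
      using assms S_subset l by (auto simp: PiE_iff extensional_def)
  qed
qed

section \<open>Extending operator tuples by zero\<close>

lemma extension_bounded:
  assumes "T \<in> bounded_operators K (X l) (X l)"
  shows "(\<lambda>y. E (T (y l))) \<in> bounded_operators K Y Y"
proof -
  note T = bounded_operatorsD[OF assms]
  obtain C where C: "\<And>x. x \<in> carrier (X l) \<Longrightarrow> nrm (X l) (T x) \<le> C * nrm (X l) x"
    using assms unfolding bounded_operators_def by blast
  \<comment> \<open>The constant \<open>C\<close> may be negative; its absolute value allows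
    \<open>coordinate_le\<close> to be multiplied by it.\<close>
  have "N (E (T (y l))) \<le> \<bar>C\<bar> * N y" if "y \<in> S" for y
  proof -
    have y: "y l \<in> carrier (X l)"
      using coordinate_mem that .
    have "N (E (T (y l))) \<le> C * nrm (X l) (y l)"
      using C y T by (simp add: N_E)
    also have "\<dots> \<le> \<bar>C\<bar> * nrm (X l) (y l)"
      using Xl.nrm_nonneg[OF y minus_one_mem] by (intro mult_right_mono) auto
    also have "\<dots> \<le> \<bar>C\<bar> * N y"
      using coordinate_le[OF that] by (intro mult_left_mono) auto
    finally show ?thesis .
  qed
  then show ?thesis
    unfolding bounded_operators_def
    using l T E_mem coordinate_mem E_add E_smult by (auto intro!: exI[of _ "\<bar>C\<bar>"])
qed

text \<open>A unit vector of \<open>Y\<close> has its coordinate \<open>v\<close> only in the unit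
  ball of \<open>X l\<close>; moving \<open>v\<close> out to the sphere does not decrease any norm
  of \<open>T i v\<close>. Conversely, \<open>E\<close> embeds the unit sphere of \<open>X l\<close>
  into that of \<open>Y\<close>.\<close>

lemma joint_norm_extension:
  assumes p: "0 < p" and T: "\<And>i. i \<in> {1..k} \<Longrightarrow> T i \<in> bounded_operators K (X l) (X l)"
  shows "joint_norm p k Y (\<lambda>i y. E (T i (y l))) = joint_norm p k (X l) T"
proof (rule antisym)
  show "joint_norm p k Y (\<lambda>i y. E (T i (y l))) \<le> joint_norm p k (X l) T"
    unfolding joint_norm_def
  proof (rule SUP_least)
    fix y
    assume "y \<in> unit_sphere Y"
    then have y: "y \<in> S" "N y = 1"
      by (auto simp: unit_sphere_def)
    define v where "v = y l"
    have v: "v \<in> carrier (X l)" "nrm (X l) v \<le> 1"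
      using coordinate_mem[OF y(1)] coordinate_le[OF y(1)] y(2) by (auto simp: v_def)
    have eq: "(\<Sum>i=1..k. nrm Y (E (T i (y l))) powr p) = (\<Sum>i=1..k. nrm (X l) (T i v) powr p)"
      using bounded_operatorsD(1)[OF T] v by (intro sum.cong) (auto simp: N_E v_def)
    show "ennreal ((\<Sum>i=1..k. nrm Y (E (T i (y l))) powr p) powr (1 / p))
        \<le> (SUP x\<in>unit_sphere (X l). ennreal ((\<Sum>i=1..k. nrm (X l) (T i x) powr p) powr (1 / p)))"
    proof (cases "nrm (X l) v = 0")
      case True
      \<comment> \<open>A zero coordinate cannot be normalised, but then all \<open>T i v\<close>
        vanish and the left side is 0.\<close>
      then have "v = \<zero>\<^bsub>X l\<^esub>"
        using Xl.nrm_eq_0_iff v by simp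
      then have "(\<Sum>i=1..k. nrm (X l) (T i v) powr p) = 0"
        using T by (intro sum.neutral) (auto simp: Xl.bounded_operator_zero)
      then show ?thesis
        using eq by simp
    next
      case False
      then obtain u where u: "u \<in> unit_sphere (X l)"
        and vu: "v = complex_of_real (nrm (X l) v) \<odot>\<^bsub>X l\<^esub> u"
        using Xl.unit_vector v reals_subset by blast
      have s: "complex_of_real (nrm (X l) v) \<in> K"
        using reals_subset by auto
      have "nrm (X l) (T i v) \<le> nrm (X l) (T i u)" if "i \<in> {1..k}" for i
      proof -
        note Ti = bounded_operatorsD[OF T[OF that]]
        have "T i u \<in> carrier (X l)"
          using Ti u by (simp add: unit_sphere_def)
        moreover have "T i v = complex_of_real (nrm (X l) v) \<odot>\<^bsub>X l\<^esub> T i u"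
          using Ti(3)[OF s, of u] u vu by (simp add: unit_sphere_def)
        ultimately have "nrm (X l) (T i v) = \<bar>nrm (X l) v\<bar> * nrm (X l) (T i u)"
          using Xl.nrm_smult[OF s] by simp
        moreover have "0 \<le> nrm (X l) v" "0 \<le> nrm (X l) (T i u)"
          using Xl.nrm_nonneg minus_one_mem v \<open>T i u \<in> carrier (X l)\<close> by auto
        ultimately show ?thesis
          using v(2) by (simp add: mult_left_le_one_le)
      qed
      then have "(\<Sum>i=1..k. nrm (X l) (T i v) powr p) powr (1 / p)
          \<le> (\<Sum>i=1..k. nrm (X l) (T i u) powr p) powr (1 / p)"
        using p v bounded_operatorsD(1)[OF T] Xl.nrm_nonneg[OF _ minus_one_mem]
        by (intro powr_sum_mono) auto
      then show ?thesis
        unfolding eq using u by (intro SUP_upper2[of u]) (auto intro: ennreal_leI)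
    qed
  qed
  show "joint_norm p k (X l) T \<le> joint_norm p k Y (\<lambda>i y. E (T i (y l)))"
    unfolding joint_norm_def
  proof (rule SUP_least)
    fix x
    assume "x \<in> unit_sphere (X l)"
    then have x: "x \<in> carrier (X l)" and Ex: "E x \<in> unit_sphere Y"
      by (auto simp: unit_sphere_def E_mem N_E)
    have "(\<Sum>i=1..k. nrm (X l) (T i x) powr p) = (\<Sum>i=1..k. nrm Y (E (T i (E x l))) powr p)"
      using bounded_operatorsD(1)[OF T] x by (intro sum.cong) (auto simp: E_apply N_E)
    then show "ennreal ((\<Sum>i=1..k. nrm (X l) (T i x) powr p) powr (1 / p))
        \<le> (SUP y\<in>unit_sphere Y.
              ennreal ((\<Sum>i=1..k. nrm Y (E (T i (y l))) powr p) powr (1 / p)))"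
      using Ex by (intro SUP_upper2[of "E x"]) auto
  qed
qed

section \<open>Restricting norming functionals to the summand\<close>

lemma restriction_bounded:
  assumes "f \<in> bounded_operators K Y (scalars K)"
  shows "(\<lambda>v. f (E v)) \<in> bounded_operators K (X l) (scalars K)"
proof -
  note f = bounded_operatorsD[OF assms]
  obtain C where "\<forall>y\<in>S. cmod (f y) \<le> C * N y"
    using assms unfolding bounded_operators_def by auto
  then have "\<forall>v\<in>carrier (X l). cmod (f (E v)) \<le> C * nrm (X l) v"
    using E_mem N_E by metis
  moreover have "f (E (v \<oplus>\<^bsub>X l\<^esub> w)) = f (E v) + f (E w)"
    if "v \<in> carrier (X l)" "w \<in> carrier (X l)" for v w
    using f(2)[of "E v" "E w"] E_add E_mem that by (simp del: family_space_simps(3))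
  moreover have "f (E (c \<odot>\<^bsub>X l\<^esub> v)) = c * f (E v)"
    if "c \<in> K" "v \<in> carrier (X l)" for c v
    using f(3)[OF that(1), of "E v"] E_smult[OF that(1)] E_mem that
    by (simp del: family_space_simps(4))
  ultimately show ?thesis
    using f(1) E_mem by (auto simp: bounded_operators_def)
qed

text \<open>For real parts, compare \<open>f\<close> at \<open>y(l := u)\<close>, where its real
  part is at most 1, with \<open>f y = 1\<close>; the contributions of the other coordinates cancel.
  Rotating \<open>v\<close> by a unimodular scalar then replaces the real part by the
  modulus.\<close>

lemma restricted_functional_max:
  assumes yf: "(y, f) \<in> Pi_set K Y" and v: "v \<in> carrier (X l)" "nrm (X l) v \<le> nrm (X l) (y l)"
  shows "cmod (f (E v)) \<le> Re (f (E (y l)))"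
proof -
  have y: "y \<in> S" "N y = 1" and f: "f \<in> dual_sphere K Y" and fy: "f y = 1"
    using yf by (auto simp: Pi_set_def unit_sphere_def)
  have f_bounded: "f \<in> bounded_operators K Y (scalars K)"
    using f by (simp add: dual_sphere_def)
  note f' = bounded_operatorsD[OF f_bounded]
  note g = bounded_operatorsD[OF restriction_bounded[OF f_bounded], simplified]
  have yl: "y l \<in> carrier (X l)"
    using coordinate_mem y by auto
  have max: "Re (f (E u)) \<le> Re (f (E (y l)))"
    if u: "u \<in> carrier (X l)" "nrm (X l) u \<le> nrm (X l) (y l)" for u
  proof -
    have d: "u \<ominus>\<^bsub>X l\<^esub> y l \<in> carrier (X l)"
      using u yl by simp
    have "(u \<ominus>\<^bsub>X l\<^esub> y l) \<oplus>\<^bsub>X l\<^esub> y l = u"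
      using u yl by (simp add: a_minus_def Xl.M.a_assoc Xl.M.l_neg)
    then have "f (E u) = f (E (u \<ominus>\<^bsub>X l\<^esub> y l)) + f (E (y l))"
      using g(2)[OF d yl] by simp
    moreover have "f (y(l := u)) = 1 + f (E (u \<ominus>\<^bsub>X l\<^esub> y l))"
      using f'(2)[of y "E (u \<ominus>\<^bsub>X l\<^esub> y l)"] update_eq_add[OF y(1) u(1)] E_mem d y fy
      by (simp del: family_space_simps(3))
    moreover have "cmod (f (y(l := u))) \<le> 1"
      using dual_sphere_bound[OF f] update_mem[OF y(1) u] update_le[OF y(1) u] y(2) by simp
    then have "Re (f (y(l := u))) \<le> 1"
      using complex_Re_le_cmod order_trans by blast
    ultimately show ?thesis
      by simp
  qed
  \<comment> \<open>The unimodular scalar that turns \<open>f (E v)\<close> into its modulus, with 1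
    chosen when that value is 0. Over the reals it is a sign, hence again in
    \<open>K\<close>.\<close>
  define w where "w = (if f (E v) = 0 then 1 else cnj (f (E v)) / cmod (f (E v)))"
  have "f (E v) \<in> K"
    using g(1) v by simp
  then have wK: "w \<in> K"
    using K by (auto simp: w_def Reals_cnj_iff intro!: Reals_divide)
  have "cmod w = 1"
    by (simp add: w_def norm_divide)
  have "w * f (E v) = cmod (f (E v))"
    using complex_norm_square[of "f (E v)"]
    by (simp add: w_def mult.commute[of "cnj _"] power2_eq_square divide_eq_eq)
  moreover have "f (E (w \<odot>\<^bsub>X l\<^esub> v)) = w * f (E v)"
    using g(3)[OF wK] v by simp
  moreover have "w \<odot>\<^bsub>X l\<^esub> v \<in> carrier (X l)" "nrm (X l) (w \<odot>\<^bsub>X l\<^esub> v) \<le> nrm (X l) (y l)"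
    using Xl.smult_closed[of w v] Xl.nrm_smult[of w v] wK v \<open>cmod w = 1\<close> by auto
  ultimately show ?thesis
    using max by (metis Re_complex_of_real)
qed

text \<open>Homogeneous form of the maximality at \<open>y l\<close>: apply it to \<open>v\<close>
  rescaled to the norm of \<open>y l\<close>. Stated without quotients, it also covers zero
  vectors.\<close>

lemma restricted_functional_bound:
  assumes yf: "(y, f) \<in> Pi_set K Y" and v: "v \<in> carrier (X l)"
  shows "nrm (X l) (y l) * cmod (f (E v)) \<le> Re (f (E (y l))) * nrm (X l) v"
proof -
  have y: "y \<in> S" and "f \<in> bounded_operators K Y (scalars K)"
    using yf by (auto simp: Pi_set_def unit_sphere_def dual_sphere_def)
  note g = bounded_operatorsD[OF restriction_bounded[OF this(2)], simplified]
  have s: "0 \<le> nrm (X l) (y l)"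
    using Xl.nrm_nonneg[OF coordinate_mem[OF y] minus_one_mem] .
  show ?thesis
  proof (cases "nrm (X l) v = 0")
    case True
    have "0 \<in> K"
      using K by auto
    then have "f (E \<zero>\<^bsub>X l\<^esub>) = 0"
      using g(3)[of 0 "\<zero>\<^bsub>X l\<^esub>"] by simp
    moreover have "v = \<zero>\<^bsub>X l\<^esub>"
      using Xl.nrm_eq_0_iff[OF v] True by simp
    ultimately show ?thesis
      by simp
  next
    case False
    then have nv: "0 < nrm (X l) v"
      using Xl.nrm_nonneg[OF v minus_one_mem] by simp
    define c where "c = nrm (X l) (y l) / nrm (X l) v"
    have c: "complex_of_real c \<in> K" and "0 \<le> c"
      using reals_subset s nv by (auto simp: c_def)
    have "cmod (f (E (of_real c \<odot>\<^bsub>X l\<^esub> v))) \<le> Re (f (E (y l)))"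
    proof (rule restricted_functional_max[OF yf])
      show "of_real c \<odot>\<^bsub>X l\<^esub> v \<in> carrier (X l)"
        using Xl.smult_closed[of "of_real c" v] c v by simp
      have "c * nrm (X l) v = nrm (X l) (y l)"
        using nv by (simp add: c_def)
      then show "nrm (X l) (of_real c \<odot>\<^bsub>X l\<^esub> v) \<le> nrm (X l) (y l)"
        using Xl.nrm_smult[OF c v] \<open>0 \<le> c\<close> by simp
    qed
    then have "c * cmod (f (E v)) \<le> Re (f (E (y l)))"
      using g(3)[OF c v] \<open>0 \<le> c\<close> by (simp add: norm_mult)
    then show ?thesis
      using nv by (simp add: c_def field_simps)
  qed
qed

text \<open>The pair consists of \<open>y l\<close> divided by its norm \<open>s\<close>, and of the
  restriction of \<open>f\<close> multiplied by \<open>s / a\<close>, where \<open>a\<close> is the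
  value of \<open>f\<close> at \<open>E (y l)\<close>. The homogeneous bound says exactly that this
  multiple has norm at most 1.\<close>

lemma restricted_Pi_set:
  assumes yf: "(y, f) \<in> Pi_set K Y" and nz: "nrm (X l) (y l) \<noteq> 0" "Re (f (E (y l))) \<noteq> 0"
  obtains u h where "(u, h) \<in> Pi_set K (X l)"
    "y l = complex_of_real (nrm (X l) (y l)) \<odot>\<^bsub>X l\<^esub> u"
    "\<And>v. nrm (X l) (y l) * cmod (f (E v)) \<le> cmod (h v)"
proof -
  define s where "s = nrm (X l) (y l)"
  define a where "a = Re (f (E (y l)))"
  have y: "y \<in> S" "N y = 1" and f: "f \<in> dual_sphere K Y"
    using yf by (auto simp: Pi_set_def unit_sphere_def)
  then have "f \<in> bounded_operators K Y (scalars K)"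
    by (simp add: dual_sphere_def)
  note g = bounded_operatorsD[OF restriction_bounded[OF this], simplified]
  have yl: "y l \<in> carrier (X l)"
    using coordinate_mem y by auto
  have "0 < s"
    using nz Xl.nrm_nonneg[OF yl minus_one_mem] by (simp add: s_def)
  have fa_le: "cmod (f (E (y l))) \<le> a"
    using restricted_functional_max[OF yf yl] by (simp add: a_def)
  then have "0 < a"
    using nz norm_ge_zero[of "f (E (y l))"] unfolding a_def by linarith
  \<comment> \<open>A complex number whose modulus is at most its real part is real.\<close>
  have fa: "f (E (y l)) = of_real a"
    using fa_le \<open>0 < a\<close> complex_Re_le_cmod[of "f (E (y l))"] Im_eq_0[of "f (E (y l))"]
    by (simp add: a_def complex_eq_iff)
  \<comment> \<open>\<open>E (y l)\<close> lies in the unit ball of \<open>Y\<close>, because a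
    coordinate of \<open>y\<close> is no longer than \<open>y\<close>.\<close>
  have "a \<le> 1"
    using dual_sphere_bound[OF f, of "E (y l)"] E_mem N_E coordinate_le[OF y(1)] y(2) yl fa \<open>0 < a\<close>
    by simp
  obtain u where u: "u \<in> unit_sphere (X l)" and yu: "y l = complex_of_real s \<odot>\<^bsub>X l\<^esub> u"
    using Xl.unit_vector[OF yl nz(1) reals_subset] by (auto simp: s_def)
  have real_mem: "complex_of_real r \<in> K" for r
    using reals_subset by auto
  \<comment> \<open>The factor \<open>s / a\<close> normalises \<open>h u\<close> to 1, since
    \<open>f (E u)\<close> equals \<open>a / s\<close>.\<close>
  define h where "h v = of_real (s / a) * f (E v)" for v
  have "f (E (y l)) = of_real s * f (E u)"
    using g(3)[OF real_mem, of u s] u yu by (simp add: unit_sphere_def)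
  then have hu: "h u = 1"
    using fa \<open>0 < a\<close> by (auto simp: h_def)
  have bound: "cmod (h v) \<le> nrm (X l) v" if "v \<in> carrier (X l)" for v
    using restricted_functional_bound[OF yf that] \<open>0 < a\<close> \<open>0 < s\<close>
    by (simp add: h_def a_def s_def norm_mult norm_divide field_simps)
  have "h \<in> dual_sphere K (X l)"
    using g mult_mem real_mem[of "s / a"] u hu bound
    by (intro dual_sphereI) (auto simp: h_def distrib_left simp del: of_real_divide)
  then have "(u, h) \<in> Pi_set K (X l)"
    using u hu by (simp add: Pi_set_def)
  \<comment> \<open>By the choice of \<open>h\<close> the two sides differ by the factor
    \<open>1 / a\<close>, which is at least 1.\<close>
  moreover have "s * cmod (f (E v)) \<le> cmod (h v)" for v
  proof -
    have "s * cmod (f (E v)) * a \<le> s * cmod (f (E v))"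
      using \<open>0 < s\<close> \<open>a \<le> 1\<close> by (intro mult_left_le) auto
    then show ?thesis
      using \<open>0 < a\<close> \<open>0 < s\<close> by (simp add: h_def norm_mult norm_divide field_simps)
  qed
  ultimately show ?thesis
    using that yu unfolding s_def by blast
qed

section \<open>Numerical radius and index of extended tuples\<close>

text \<open>Each norming pair of \<open>Y\<close> is dominated by one of \<open>X l\<close>: writing
  \<open>y l\<close> as its norm times a unit vector \<open>u\<close> pulls the norm of
  \<open>y l\<close> out of \<open>f (E (T i (y l)))\<close>, and that factor is absorbed in passing
  from the restriction of \<open>f\<close> to \<open>h\<close>.\<close>

lemma joint_numerical_radius_extension:
  assumes p: "0 < p" and T: "\<And>i. i \<in> {1..k} \<Longrightarrow> T i \<in> bounded_operators K (X l) (X l)"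
  shows "joint_numerical_radius K p k Y (\<lambda>i y. E (T i (y l)))
      \<le> joint_numerical_radius K p k (X l) T"
  unfolding joint_numerical_radius_def
proof (rule SUP_least, clarify)
  fix y f
  assume yf: "(y, f) \<in> Pi_set K Y"
  let ?s = "nrm (X l) (y l)"
  let ?w = "SUP (x, f)\<in>Pi_set K (X l).
      ennreal ((\<Sum>i=1..k. cmod (f (T i x)) powr p) powr (1 / p))"
  have y: "y \<in> S" and "f \<in> bounded_operators K Y (scalars K)"
    using yf by (auto simp: Pi_set_def unit_sphere_def dual_sphere_def)
  note g = bounded_operatorsD[OF restriction_bounded[OF this(2)], simplified]
  have yl: "y l \<in> carrier (X l)"
    using coordinate_mem y by auto
  have Ty: "T i (y l) \<in> carrier (X l)" if "i \<in> {1..k}" for i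
    using bounded_operatorsD(1)[OF T[OF that]] yl .
  show "ennreal ((\<Sum>i=1..k. cmod (f (E (T i (y l)))) powr p) powr (1 / p)) \<le> ?w"
  proof (cases "?s = 0 \<or> Re (f (E (y l))) = 0")
    case True
    \<comment> \<open>In the degenerate cases there is no pair to restrict to. Either
      \<open>y l\<close> is zero, and so is \<open>T i (y l)\<close>, or
      \<open>restricted_functional_bound\<close> with right side 0 makes \<open>f\<close> vanish on
      the whole embedded summand.\<close>
    have "f (E (T i (y l))) = 0" if i: "i \<in> {1..k}" for i
    proof (cases "?s = 0")
      case True
      then have "T i (y l) = \<zero>\<^bsub>X l\<^esub>"
        using Xl.nrm_eq_0_iff[OF yl] Xl.bounded_operator_zero[OF T[OF i]] by simp
      moreover have "0 \<in> K"
        using K by auto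
      then have "f (E \<zero>\<^bsub>X l\<^esub>) = 0"
        using g(3)[of 0 "\<zero>\<^bsub>X l\<^esub>"] by simp
      ultimately show ?thesis
        by simp
    next
      case False
      then have "0 < ?s"
        using Xl.nrm_nonneg[OF yl minus_one_mem] by simp
      then show ?thesis
        using restricted_functional_bound[OF yf Ty[OF i]] \<open>?s = 0 \<or> Re (f (E (y l))) = 0\<close>
        by (simp add: mult_le_0_iff)
    qed
    then show ?thesis
      by simp
  next
    case False
    then obtain u h where uh: "(u, h) \<in> Pi_set K (X l)"
      and yu: "y l = complex_of_real ?s \<odot>\<^bsub>X l\<^esub> u"
      and h: "\<And>v. ?s * cmod (f (E v)) \<le> cmod (h v)"
      using restricted_Pi_set[OF yf] by blast
    have u: "u \<in> carrier (X l)"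
      using uh by (simp add: Pi_set_def unit_sphere_def)
    have s: "complex_of_real ?s \<in> K" "0 \<le> ?s"
      using reals_subset Xl.nrm_nonneg[OF yl minus_one_mem] by auto
    have "cmod (f (E (T i (y l)))) \<le> cmod (h (T i u))" if i: "i \<in> {1..k}" for i
    proof -
      note Ti = bounded_operatorsD[OF T[OF i]]
      have "T i (y l) = complex_of_real ?s \<odot>\<^bsub>X l\<^esub> T i u"
        using Ti(3)[OF s(1) u] yu by simp
      then have "f (E (T i (y l))) = complex_of_real ?s * f (E (T i u))"
        using g(3)[OF s(1) Ti(1)[OF u]] by simp
      then show ?thesis
        using h s(2) by (simp add: norm_mult)
    qed
    then have "(\<Sum>i=1..k. cmod (f (E (T i (y l)))) powr p) powr (1 / p)
        \<le> (\<Sum>i=1..k. cmod (h (T i u)) powr p) powr (1 / p)"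
      using p by (intro powr_sum_mono) auto
    then show ?thesis
      using uh by (intro SUP_upper2[of "(u, h)"]) (auto intro: ennreal_leI)
  qed
qed

text \<open>Extension by zero sends every tuple admissible for \<open>X l\<close> to one admissible
  for \<open>Y\<close> without raising the numerical radius, so the infimum for \<open>Y\<close> is
  at most that for \<open>X l\<close>.\<close>

lemma joint_numerical_index_le:
  assumes "0 < p"
  shows "joint_numerical_index K p k Y \<le> joint_numerical_index K p k (X l)"
  unfolding joint_numerical_index_def[of K p k "X l"]
proof (rule INF_greatest, clarify)
  fix T
  assume T: "\<forall>i\<in>{1..k}. T i \<in> bounded_operators K (X l) (X l)" and "joint_norm p k (X l) T = 1"
  then have "joint_norm p k Y (\<lambda>i y. E (T i (y l))) = 1"
    using joint_norm_extension[OF assms, of k T] by simp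
  then have "joint_numerical_index K p k Y
      \<le> joint_numerical_radius K p k Y (\<lambda>i y. E (T i (y l)))"
    unfolding joint_numerical_index_def using extension_bounded T by (intro INF_lower) auto
  also have "\<dots> \<le> joint_numerical_radius K p k (X l) T"
    using joint_numerical_radius_extension[OF assms] T by simp
  finally show "joint_numerical_index K p k Y \<le> joint_numerical_radius K p k (X l) T" .
qed

end

section \<open>The l_q- and c_0-sums as instances\<close>

lemma sup_nrm_upper:
  assumes "bdd_above ((\<lambda>j. nrm (X j) (x j)) ` I)" "l \<in> I"
  shows "nrm (X l) (x l) \<le> sup_nrm I X x"
  unfolding sup_nrm_def using assms by (intro cSUP_upper)

lemma sup_nrm_mono:
  assumes "I \<noteq> {}" "bdd_above ((\<lambda>j. nrm (X j) (y j)) ` I)"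
    and "\<And>j. j \<in> I \<Longrightarrow> nrm (X j) (x j) \<le> nrm (X j) (y j)"
  shows "sup_nrm I X x \<le> sup_nrm I X y"
  unfolding sup_nrm_def
proof (rule cSUP_mono[OF assms(1,2)])
  show "\<exists>i\<in>I. nrm (X j) (x j) \<le> nrm (X i) (y i)" if "j \<in> I" for j
    using assms(3)[OF that] that by (rule bexI)
qed

context
  fixes K :: "complex set" and I :: "'i set" and X :: "'i \<Rightarrow> 'a normed_module" and l :: 'i
  assumes K: "K = \<real> \<or> K = UNIV"
    and normed: "\<And>j. j \<in> I \<Longrightarrow> normed_space K (X j)"
    and l: "l \<in> I"
begin

lemma family_nrm_zero: "j \<in> I \<Longrightarrow> nrm (X j) \<zero>\<^bsub>X j\<^esub> = 0"
  by (rule normed_space.nrm_zero) (rule normed)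

lemma family_nrm_nonneg: "j \<in> I \<Longrightarrow> x \<in> carrier (X j) \<Longrightarrow> 0 \<le> nrm (X j) x"
  using normed_space.nrm_nonneg[of K "X j" x] normed[of j] K by auto

lemma embedding_PiE:
  assumes "u \<in> carrier (X l)"
  shows "(\<lambda>j\<in>I. if j = l then u else \<zero>\<^bsub>X j\<^esub>) \<in> (\<Pi>\<^sub>E j\<in>I. carrier (X j))"
proof -
  have "\<zero>\<^bsub>X j\<^esub> \<in> carrier (X j)" if "j \<in> I" for j
  proof -
    interpret normed_space K "X j"
      using normed that .
    show ?thesis
      by simp
  qed
  then show ?thesis
    using assms by auto
qed

lemma update_PiE:
  assumes "y \<in> (\<Pi>\<^sub>E j\<in>I. carrier (X j))" "u \<in> carrier (X l)"
  shows "y(l := u) \<in> (\<Pi>\<^sub>E j\<in>I. carrier (X j))"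
  using assms l by (auto simp: PiE_iff extensional_def)

lemma sup_nrm_embedding:
  assumes "u \<in> carrier (X l)"
  shows "bdd_above ((\<lambda>j. nrm (X j) ((\<lambda>j\<in>I. if j = l then u else \<zero>\<^bsub>X j\<^esub>) j)) ` I)" (is ?bdd)
    and "sup_nrm I X (\<lambda>j\<in>I. if j = l then u else \<zero>\<^bsub>X j\<^esub>) = nrm (X l) u"
proof -
  let ?x = "\<lambda>j\<in>I. if j = l then u else \<zero>\<^bsub>X j\<^esub>"
  have le: "nrm (X j) (?x j) \<le> nrm (X l) u" if "j \<in> I" for j
    using that family_nrm_zero family_nrm_nonneg[OF l assms] by auto
  then show bdd: ?bdd
    by (intro bdd_aboveI[of _ "nrm (X l) u"]) auto
  show "sup_nrm I X ?x = nrm (X l) u"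
  proof (rule antisym)
    show "sup_nrm I X ?x \<le> nrm (X l) u"
      unfolding sup_nrm_def using le l by (intro cSUP_least) blast+
    show "nrm (X l) u \<le> sup_nrm I X ?x"
      using sup_nrm_upper[of X ?x I l] bdd l by simp
  qed
qed

text \<open>Common to the l_infinity- and the c_0-sum, which share the supremum norm and differ in
  the carrier. The assumption \<open>solid\<close> makes the carrier stable under shrinking
  coordinates, in particular under the updates of \<open>monotone_sum\<close>.\<close>

lemma monotone_sum_sup:
  assumes S: "S \<subseteq> (\<Pi>\<^sub>E j\<in>I. carrier (X j))"
    and bdd: "\<And>y. y \<in> S \<Longrightarrow> bdd_above ((\<lambda>j. nrm (X j) (y j)) ` I)"
    and emb: "\<And>u. u \<in> carrier (X l) \<Longrightarrow> (\<lambda>j\<in>I. if j = l then u else \<zero>\<^bsub>X j\<^esub>) \<in> S"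
    and solid: "\<And>x y. \<lbrakk>x \<in> (\<Pi>\<^sub>E j\<in>I. carrier (X j)); y \<in> S;
          \<And>j. j \<in> I \<Longrightarrow> nrm (X j) (x j) \<le> nrm (X j) (y j)\<rbrakk> \<Longrightarrow> x \<in> S"
  shows "monotone_sum K I X S (sup_nrm I X) l"
proof (rule monotone_sum.intro)
  fix y u
  assume y: "y \<in> S" and u: "u \<in> carrier (X l)" "nrm (X l) u \<le> nrm (X l) (y l)"
  have le: "nrm (X j) ((y(l := u)) j) \<le> nrm (X j) (y j)" for j
    using u(2) by simp
  show "y(l := u) \<in> S"
    using update_PiE[OF subsetD[OF S y] u(1)] y le by (rule solid)
  show "sup_nrm I X (y(l := u)) \<le> sup_nrm I X y"
    using l by (intro sup_nrm_mono bdd[OF y] le) blast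
next
  fix y
  assume "y \<in> S"
  then show "nrm (X l) (y l) \<le> sup_nrm I X y"
    by (intro sup_nrm_upper bdd l)
qed (rule K l S emb sup_nrm_embedding(2) | erule normed | assumption)+

text \<open>All conditions are termwise comparisons of series with nonnegative terms; the series of
  an embedded vector has at most one nonzero term.\<close>

lemma monotone_sum_lr:
  assumes r: "1 \<le> r"
  shows "monotone_sum K I X
      {x \<in> (\<Pi>\<^sub>E j\<in>I. carrier (X j)). (\<lambda>j. nrm (X j) (x j) powr r) summable_on I}
      (\<lambda>x. (\<Sum>\<^sub>\<infinity>j\<in>I. nrm (X j) (x j) powr r) powr (1 / r)) l"
    (is "monotone_sum _ _ _ ?S ?N _")
proof (rule monotone_sum.intro)
  fix y
  assume y: "y \<in> ?S"
  have yl: "0 \<le> nrm (X l) (y l)"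
    using y l family_nrm_nonneg by (auto simp: PiE_iff)
  have "(\<Sum>\<^sub>\<infinity>j\<in>{l}. nrm (X j) (y j) powr r) \<le> (\<Sum>\<^sub>\<infinity>j\<in>I. nrm (X j) (y j) powr r)"
    using y l by (intro infsum_mono_neutral) auto
  then have "(nrm (X l) (y l) powr r) powr (1 / r) \<le> ?N y"
    using r by (intro powr_mono2) auto
  \<comment> \<open>The two powers cancel only because the norm is nonnegative.\<close>
  then show "nrm (X l) (y l) \<le> ?N y"
    using r yl by (simp add: powr_powr)
  fix u
  assume u: "u \<in> carrier (X l)" "nrm (X l) u \<le> nrm (X l) (y l)"
  have le: "nrm (X j) ((y(l := u)) j) powr r \<le> nrm (X j) (y j) powr r" if "j \<in> I" for j
    using u r family_nrm_nonneg[OF l u(1)] by (auto intro: powr_mono2)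
  have summable: "(\<lambda>j. nrm (X j) ((y(l := u)) j) powr r) summable_on I"
    using y by (intro summable_on_comparison_test[OF _ le]) auto
  then show "y(l := u) \<in> ?S"
    using y u update_PiE by auto
  show "?N (y(l := u)) \<le> ?N y"
    using r summable y by (intro powr_mono2 infsum_mono[OF _ _ le] infsum_nonneg) auto
next
  fix u
  assume u: "u \<in> carrier (X l)"
  let ?x = "\<lambda>j\<in>I. if j = l then u else \<zero>\<^bsub>X j\<^esub>"
  have zero: "nrm (X j) (?x j) powr r = 0" if "j \<in> I - {l}" for j
    using that family_nrm_zero by simp
  \<comment> \<open>Off \<open>l\<close> the terms are \<open>0 powr r\<close>, that is 0, so
    \<open>I\<close> may be replaced by \<open>{l}\<close>.\<close>
  have "(\<lambda>j. nrm (X j) (?x j) powr r) summable_on I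
      \<longleftrightarrow> (\<lambda>j. nrm (X j) (?x j) powr r) summable_on {l}"
    using zero l by (intro summable_on_cong_neutral) auto
  then show "?x \<in> ?S"
    using embedding_PiE[OF u] by simp
  have "(\<Sum>\<^sub>\<infinity>j\<in>I. nrm (X j) (?x j) powr r) = (\<Sum>\<^sub>\<infinity>j\<in>{l}. nrm (X j) (?x j) powr r)"
    using zero l by (intro infsum_cong_neutral) auto
  then show "?N ?x = nrm (X l) u"
    using r l family_nrm_nonneg[OF l u] by (simp add: powr_powr)
next
  show "?S \<subseteq> (\<Pi>\<^sub>E j\<in>I. carrier (X j))"
    by blast
qed (rule K l | erule normed)+

lemma lq_sum_index_le:
  assumes "1 \<le> q" "0 < p"
  shows "joint_numerical_index K p k (lq_sum q I X) \<le> joint_numerical_index K p k (X l)"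
proof (cases "q = \<infinity>")
  case True
  have "monotone_sum K I X
      {x \<in> (\<Pi>\<^sub>E j\<in>I. carrier (X j)). bdd_above ((\<lambda>j. nrm (X j) (x j)) ` I)} (sup_nrm I X) l"
  proof (rule monotone_sum_sup)
    fix x y
    assume "x \<in> (\<Pi>\<^sub>E j\<in>I. carrier (X j))"
      "y \<in> {x \<in> (\<Pi>\<^sub>E j\<in>I. carrier (X j)). bdd_above ((\<lambda>j. nrm (X j) (x j)) ` I)}"
      "\<And>j. j \<in> I \<Longrightarrow> nrm (X j) (x j) \<le> nrm (X j) (y j)"
    then show "x \<in> {x \<in> (\<Pi>\<^sub>E j\<in>I. carrier (X j)). bdd_above ((\<lambda>j. nrm (X j) (x j)) ` I)}"
      by (auto simp: bdd_above_def) (meson order_trans)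
  qed (use embedding_PiE sup_nrm_embedding in auto)
  then show ?thesis
    using monotone_sum.joint_numerical_index_le assms True by (simp add: lq_sum_def)
next
  case False
  \<comment> \<open>A finite \<open>q\<close> that is at least 1 is a real number, so the conversion
    preserves its value.\<close>
  then have "1 \<le> real_of_ereal q"
    using assms(1) by (cases q) auto
  then show ?thesis
    using monotone_sum.joint_numerical_index_le[OF monotone_sum_lr] assms False
    by (simp add: lq_sum_def Let_def)
qed

lemma c0_sum_index_le:
  assumes "0 < p"
  shows "joint_numerical_index K p k (c0_sum I X) \<le> joint_numerical_index K p k (X l)"
proof -
  let ?S = "{x \<in> (\<Pi>\<^sub>E j\<in>I. carrier (X j)). \<forall>\<epsilon>>0. finite {j \<in> I. nrm (X j) (x j) \<ge> \<epsilon>}}"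
  have "monotone_sum K I X ?S (sup_nrm I X) l"
  proof (rule monotone_sum_sup)
    fix y
    assume "y \<in> ?S"
    \<comment> \<open>The threshold 1 is arbitrary: only finitely many coordinate norms reach it and
      the rest lie below it, so the family is bounded.\<close>
    then have "finite {j \<in> I. nrm (X j) (y j) \<ge> 1}"
      by simp
    then have "bdd_above ((\<lambda>j. nrm (X j) (y j)) ` {j \<in> I. nrm (X j) (y j) \<ge> 1} \<union> {..1})"
      by (intro bdd_above_Un[THEN iffD2] conjI bdd_above_finite finite_imageI bdd_above_Iic)
    moreover have "(\<lambda>j. nrm (X j) (y j)) ` I
        \<subseteq> (\<lambda>j. nrm (X j) (y j)) ` {j \<in> I. nrm (X j) (y j) \<ge> 1} \<union> {..1}"
      by auto
    ultimately show "bdd_above ((\<lambda>j. nrm (X j) (y j)) ` I)"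
      by (rule bdd_above_mono)
  next
    fix u
    assume u: "u \<in> carrier (X l)"
    let ?x = "\<lambda>j\<in>I. if j = l then u else \<zero>\<^bsub>X j\<^esub>"
    have "{j \<in> I. nrm (X j) (?x j) \<ge> \<epsilon>} \<subseteq> {l}" if "0 < \<epsilon>" for \<epsilon> :: real
      using that family_nrm_zero by (auto split: if_splits)
    then have "finite {j \<in> I. nrm (X j) (?x j) \<ge> \<epsilon>}" if "0 < \<epsilon>" for \<epsilon> :: real
      using that finite_subset[of _ "{l}"] by blast
    then show "?x \<in> ?S"
      using embedding_PiE[OF u] by blast
  next
    fix x y
    assume x: "x \<in> (\<Pi>\<^sub>E j\<in>I. carrier (X j))" and y: "y \<in> ?S"
      and le: "\<And>j. j \<in> I \<Longrightarrow> nrm (X j) (x j) \<le> nrm (X j) (y j)"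
    \<comment> \<open>Smaller coordinates have smaller superlevel sets, so finiteness passes from
      \<open>y\<close> to \<open>x\<close>.\<close>
    have "{j \<in> I. nrm (X j) (x j) \<ge> \<epsilon>} \<subseteq> {j \<in> I. nrm (X j) (y j) \<ge> \<epsilon>}" for \<epsilon>
      using le by (auto intro: order_trans)
    moreover have "finite {j \<in> I. nrm (X j) (y j) \<ge> \<epsilon>}" if "0 < \<epsilon>" for \<epsilon>
      using y that by blast
    ultimately have "finite {j \<in> I. nrm (X j) (x j) \<ge> \<epsilon>}" if "0 < \<epsilon>" for \<epsilon>
      using that by (blast intro: finite_subset)
    then show "x \<in> ?S"
      using x by blast
  qed auto
  then show ?thesis
    using monotone_sum.joint_numerical_index_le assms by (simp add: c0_sum_def)
qed

end

theorem theorem3p3: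
  fixes K :: "complex set"
    and I :: "'i set"
    and X :: "'i \<Rightarrow> 'a normed_module"
    and Y :: "('i \<Rightarrow> 'a) normed_module"
    and p :: real
    and k :: nat
  assumes "K = \<real> \<or> K = UNIV"
    and "I \<noteq> {}"
    and "\<And>l. l \<in> I \<Longrightarrow> banach_space K (X l)"
    and "\<And>l. l \<in> I \<Longrightarrow> carrier (X l) \<noteq> {\<zero>\<^bsub>X l\<^esub>}"
    and "1 \<le> p"
    and "1 \<le> k"
    and "(\<exists>q. 1 \<le> q \<and> Y = lq_sum q I X) \<or> Y = c0_sum I X"
  shows "joint_numerical_index K p k Y \<le> (INF l\<in>I. joint_numerical_index K p k (X l))"
proof (rule INF_greatest)
  fix l
  assume l: "l \<in> I"
  have normed: "\<And>j. j \<in> I \<Longrightarrow> normed_space K (X j)"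
    using assms(3) by (simp add: banach_space_def)
  have p: "0 < p"
    using assms(5) by simp
  from assms(7) show "joint_numerical_index K p k Y \<le> joint_numerical_index K p k (X l)"
  proof (elim disjE exE conjE)
    fix q :: ereal
    assume "1 \<le> q" "Y = lq_sum q I X"
    then show ?thesis
      using lq_sum_index_le[OF assms(1) _ l, of X q p k] normed p by blast
  next
    assume "Y = c0_sum I X"
    then show ?thesis
      using c0_sum_index_le[OF assms(1) _ l, of X p k] normed p by blast
  qed
qed

end
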